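(* For any solution of the fully discrete MHD scheme (a)–(g) described in the context, the following discrete energy law holds at each time step: $$(D_t\bm{u}_h,\bm{u}_h)+\mathsf{c}\,(D_t\bm{B}_h,\bm{B}_h)+R_e^{-1}\|\nabla\times\bm{u}_h\|^2+\mathsf{c}R_m^{-1}\|\bm{j}_h\|^2=(\bm{f},\bm{u}_h).$$ Moreover (for finite $R_e$), for every $n\ge 0$, $$\tfrac12\left(\|\bm{u}_h^{n+1}\|^2+\mathsf{c}\|\bm{B}_h^{n+1}\|^2\right)\le \tfrac12\left(\|\bm{u}_h^{0}\|^2+\mathsf{c}\|\bm{B}_h^{0}\|^2\right)-\tfrac12R_e^{-1}\sum_{j=0}^{n}\Delta t\,\|\nabla\times\bm{u}_h^{j+1/2}\|^2-\mathsf{c}R_m^{-1}\sum_{j=0}^{n}\Delta t\,\|\nabla_h\times\bm{B}_h^{j+1/2}\|^2+\tfrac12\Delta t\,c_p^2R_e\sum_{j=0}^{n}\|\bm{f}^{j+1/2}\|^2,$$ where $c_p$ is the constant in the Poincaré inequality $\|\bm{w}_h\|\le c_p\|\nabla\times\bm{w}_h\|$ for $\bm{w}_h\in H_0^h(\mathrm{curl},\Omega)$ satisfying $\nabla_h\cdot\bm{w}_h=0$.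
   Context: $\Omega\subset\mathbb{R}^3$ is a contractible bounded Lipschitz domain with unit outer normal $\bm{n}$; $(\cdot,\cdot)$ and $\|\cdot\|$ are the $L^2(\Omega)$ inner product and norm. $H_0(\mathrm{grad},\Omega)$, $H_0(\mathrm{curl},\Omega)$, $H_0(\mathrm{div},\Omega)$ are the usual spaces of $L^2$ fields with $L^2$ gradient/curl/divergence and vanishing trace $v$, $v\times \bm{n}$, $v\cdot\bm{n}$ on $\partial\Omega$, respectively; $L^2_0(\Omega)$ is the space of mean-zero $L^2$ functions. $H_0^h(\mathrm{grad},\Omega)$, $H_0^h(\mathrm{curl},\Omega)$, $H_0^h(\mathrm{div},\Omega)$, $L_0^{2,h}(\Omega)$ are finite-dimensional (piecewise polynomial finite element) subspaces of these spaces forming a discrete de Rham complex $$0\to H_0^h(\mathrm{grad},\Omega)\xrightarrow{\mathrm{grad}} H_0^h(\mathrm{curl},\Omega)\xrightarrow{\mathrm{curl}} H_0^h(\mathrm{div},\Omega)\xrightarrow{\mathrm{div}} L_0^{2,h}(\Omega)\to 0,$$ which is exact. Discrete operators: the discrete curl $\nabla_h\times:H_0^h(\mathrm{div},\Omega)\to H_0^h(\mathrm{curl},\Omega)$ is defined by $(\nabla_h\times\bm{U},\bm{V})=(\bm{U},\nabla\times\bm{V})$ for all $\bm{V}\in H_0^h(\mathrm{curl},\Omega)$; the discrete divergence $\nabla_h\cdot:H_0^h(\mathrm{curl},\Omega)\to H_0^h(\mathrm{grad},\Omega)$ is defined by $(\nabla_h\cdot\bm{v}_h,\phi_h)=-(\bm{v}_h,\nabla\phi_h)$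 for all $\phi_h\in H_0^h(\mathrm{grad},\Omega)$. Scheme. Let $\Delta t>0$ be the time step, $\mathsf{c}>0$ the coupling number, $R_e,R_m\in(0,\infty]$ the fluid and magnetic Reynolds numbers (with $R^{-1}=0$ when $R=\infty$), and $\bm{f}$ a given $[L^2(\Omega)]^3$ source (evaluated at the midpoint of each time interval, written $\bm{f}^{n+1/2}$). Given $(\bm{u}_h^0,\bm{B}_h^0)\in H_0^h(\mathrm{curl},\Omega)\times H_0^h(\mathrm{div},\Omega)$, for $n=0,1,2,\dots$ one seeks $\bm{u}_h^{n+1},\bm{\omega}_h^{n+1/2},\bm{j}_h^{n+1/2},\bm{E}_h^{n+1/2},\bm{H}_h^{n+1/2}\in H_0^h(\mathrm{curl},\Omega)$, $\bm{B}_h^{n+1}\in H_0^h(\mathrm{div},\Omega)$, $P_h^{n+1/2}\in H_0^h(\mathrm{grad},\Omega)$ such that for all $\bm{v}_h,\bm{\mu}_h,\bm{k}_h,\bm{F}_h,\bm{G}_h\in H_0^h(\mathrm{curl},\Omega)$, $\bm{C}_h\in H_0^h(\mathrm{div},\Omega)$, $Q_h\in H_0^h(\mathrm{grad},\Omega)$: (a) $(D_t\bm{u}_h,\bm{v}_h)-(\bm{u}_h\times\bm{\omega}_h,\bm{v}_h)+R_e^{-1}(\nabla\times\bm{u}_h,\nabla\times\bm{v}_h)+(\nabla P_h,\bm{v}_h)-\mathsf{c}(\bm{j}_h\times\bm{H}_h,\bm{v}_h)=(\bm{f},\bm{v}_h)$; (b) $(D_t\bm{B}_h,\bm{C}_h)+(\nabla\times\bm{E}_h,\bm{C}_h)=0$;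 (c) $(R_m^{-1}\bm{j}_h-[\bm{E}_h+\bm{u}_h\times\bm{H}_h],\bm{G}_h)=0$; (d) $(\bm{\omega}_h,\bm{\mu}_h)-(\nabla\times\bm{u}_h,\bm{\mu}_h)=0$; (e) $(\bm{j}_h,\bm{k}_h)-(\bm{B}_h,\nabla\times\bm{k}_h)=0$; (f) $(\bm{B}_h,\bm{F}_h)-(\bm{H}_h,\bm{F}_h)=0$; (g) $(\bm{u}_h,\nabla Q_h)=0$. Here $D_t\bm{u}_h=(\bm{u}_h^{n+1}-\bm{u}_h^n)/\Delta t$, $D_t\bm{B}_h=(\bm{B}_h^{n+1}-\bm{B}_h^n)/\Delta t$, $\bm{u}_h=\bm{u}_h^{n+1/2}=(\bm{u}_h^{n+1}+\bm{u}_h^n)/2$, $\bm{B}_h=\bm{B}_h^{n+1/2}=(\bm{B}_h^{n+1}+\bm{B}_h^n)/2$, and $\bm{\omega}_h,\bm{j}_h,\bm{E}_h,\bm{H}_h,P_h$ denote the midpoint unknowns with superscript $n+1/2$. *)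

theory Defs
  imports "HOL-Analysis.Analysis"
begin

section \<open>The domain\<close>

text \<open>Near each boundary point, in coordinates whose last axis is some unit vector \<open>e\<close>, the set is the
  region strictly below the graph of a Lipschitz function \<open>g\<close> of the orthogonal projection of \<open>x\<close> onto
  the plane perpendicular to \<open>e\<close>. Since \<open>U\<close> is open, this also describes the boundary in \<open>U\<close> as the
  graph itself.\<close>

definition bounded_lipschitz_domain :: "(real^3) set \<Rightarrow> bool" where
  "bounded_lipschitz_domain \<Omega> \<longleftrightarrow>
     open \<Omega> \<and> connected \<Omega> \<and> \<Omega> \<noteq> {} \<and> bounded \<Omega> \<and>
     (\<forall>p\<in>frontier \<Omega>. \<exists>e U g L. norm e = 1 \<and> open U \<and> p \<in> U \<and>
        lipschitz_on L UNIV (g :: real^3 \<Rightarrow> real) \<and>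
        \<Omega> \<inter> U = {x \<in> U. x \<bullet> e < g (x - (x \<bullet> e) *\<^sub>R e)})"

section \<open>Square-integrable fields\<close>

text \<open>Elements of $L^2$ are represented by functions on the whole space whose values outside \<open>\<Omega>\<close> are
  irrelevant. Equality in $L^2$ is equality almost everywhere on \<open>\<Omega>\<close>.\<close>

definition L2 :: "(real^3) set \<Rightarrow> (real^3 \<Rightarrow> 'b::euclidean_space) set" where
  "L2 \<Omega> = {u \<in> borel_measurable (lebesgue_on \<Omega>). integrable (lebesgue_on \<Omega>) (\<lambda>x. (norm (u x))\<^sup>2)}"

definition l2_eq :: "(real^3) set \<Rightarrow> (real^3 \<Rightarrow> 'b::euclidean_space) \<Rightarrow> (real^3 \<Rightarrow> 'b) \<Rightarrow> bool" where
  "l2_eq \<Omega> u v \<longleftrightarrow> (AE x in lebesgue_on \<Omega>. u x = v x)"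

definition l2_inner :: "(real^3) set \<Rightarrow> (real^3 \<Rightarrow> 'b::euclidean_space) \<Rightarrow> (real^3 \<Rightarrow> 'b) \<Rightarrow> real" where
  "l2_inner \<Omega> u v = integral\<^sup>L (lebesgue_on \<Omega>) (\<lambda>x. u x \<bullet> v x)"

definition l2_norm :: "(real^3) set \<Rightarrow> (real^3 \<Rightarrow> 'b::euclidean_space) \<Rightarrow> real" where
  "l2_norm \<Omega> u = sqrt (l2_inner \<Omega> u u)"

definition L2_mean_zero :: "(real^3) set \<Rightarrow> (real^3 \<Rightarrow> real) set" where
  "L2_mean_zero \<Omega> = {q \<in> L2 \<Omega>. integral\<^sup>L (lebesgue_on \<Omega>) q = 0}"

section \<open>Smooth functions and classical differential operators\<close>

definition partial :: "3 \<Rightarrow> (real^3 \<Rightarrow> 'b::real_normed_vector) \<Rightarrow> real^3 \<Rightarrow> 'b" where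
  "partial i f x = frechet_derivative f (at x) (axis i 1)"

primrec Ck :: "nat \<Rightarrow> (real^3 \<Rightarrow> 'b::real_normed_vector) \<Rightarrow> bool" where
  "Ck 0 f = continuous_on UNIV f"
| "Ck (Suc k) f = ((\<forall>x. f differentiable (at x)) \<and> (\<forall>i. Ck k (partial i f)))"

definition smooth :: "(real^3 \<Rightarrow> 'b::real_normed_vector) \<Rightarrow> bool" where
  "smooth f \<longleftrightarrow> (\<forall>k. Ck k f)"

definition test_function :: "(real^3) set \<Rightarrow> (real^3 \<Rightarrow> 'b::real_normed_vector) \<Rightarrow> bool" where
  "test_function \<Omega> \<phi> \<longleftrightarrow> smooth \<phi> \<and> (\<exists>K. compact K \<and> K \<subseteq> \<Omega> \<and> (\<forall>x. x \<notin> K \<longrightarrow> \<phi> x = 0))"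

definition classical_grad :: "(real^3 \<Rightarrow> real) \<Rightarrow> real^3 \<Rightarrow> real^3" where
  "classical_grad f x = (\<chi> i. partial i f x)"

definition classical_curl :: "(real^3 \<Rightarrow> real^3) \<Rightarrow> real^3 \<Rightarrow> real^3" where
  "classical_curl f x =
     vector [partial 2 f x $ 3 - partial 3 f x $ 2,
             partial 3 f x $ 1 - partial 1 f x $ 3,
             partial 1 f x $ 2 - partial 2 f x $ 1]"

definition classical_div :: "(real^3 \<Rightarrow> real^3) \<Rightarrow> real^3 \<Rightarrow> real" where
  "classical_div f x = (\<Sum>i\<in>UNIV. partial i f x $ i)"

section \<open>Weak differential operators\<close>

definition is_weak_grad :: "(real^3) set \<Rightarrow> (real^3 \<Rightarrow> real) \<Rightarrow> (real^3 \<Rightarrow> real^3) \<Rightarrow> bool" where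
  "is_weak_grad \<Omega> v g \<longleftrightarrow> v \<in> L2 \<Omega> \<and> g \<in> L2 \<Omega> \<and>
     (\<forall>\<phi>. test_function \<Omega> \<phi> \<longrightarrow> l2_inner \<Omega> v (classical_div \<phi>) = - l2_inner \<Omega> g \<phi>)"

definition is_weak_curl :: "(real^3) set \<Rightarrow> (real^3 \<Rightarrow> real^3) \<Rightarrow> (real^3 \<Rightarrow> real^3) \<Rightarrow> bool" where
  "is_weak_curl \<Omega> v w \<longleftrightarrow> v \<in> L2 \<Omega> \<and> w \<in> L2 \<Omega> \<and>
     (\<forall>\<phi>. test_function \<Omega> \<phi> \<longrightarrow> l2_inner \<Omega> v (classical_curl \<phi>) = l2_inner \<Omega> w \<phi>)"

definition is_weak_div :: "(real^3) set \<Rightarrow> (real^3 \<Rightarrow> real^3) \<Rightarrow> (real^3 \<Rightarrow> real) \<Rightarrow> bool" where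
  "is_weak_div \<Omega> v d \<longleftrightarrow> v \<in> L2 \<Omega> \<and> d \<in> L2 \<Omega> \<and>
     (\<forall>\<phi>. test_function \<Omega> \<phi> \<longrightarrow> l2_inner \<Omega> v (classical_grad \<phi>) = - l2_inner \<Omega> d \<phi>)"

text \<open>Weak derivatives are unique only up to null sets; the operators below pick a representative.\<close>

definition weak_grad :: "(real^3) set \<Rightarrow> (real^3 \<Rightarrow> real) \<Rightarrow> real^3 \<Rightarrow> real^3" where
  "weak_grad \<Omega> v = (SOME g. is_weak_grad \<Omega> v g)"

definition weak_curl :: "(real^3) set \<Rightarrow> (real^3 \<Rightarrow> real^3) \<Rightarrow> real^3 \<Rightarrow> real^3" where
  "weak_curl \<Omega> v = (SOME w. is_weak_curl \<Omega> v w)"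

definition weak_div :: "(real^3) set \<Rightarrow> (real^3 \<Rightarrow> real^3) \<Rightarrow> real^3 \<Rightarrow> real" where
  "weak_div \<Omega> v = (SOME d. is_weak_div \<Omega> v d)"

definition H_grad :: "(real^3) set \<Rightarrow> (real^3 \<Rightarrow> real) set" where
  "H_grad \<Omega> = {v. \<exists>g. is_weak_grad \<Omega> v g}"

definition H_curl :: "(real^3) set \<Rightarrow> (real^3 \<Rightarrow> real^3) set" where
  "H_curl \<Omega> = {v. \<exists>w. is_weak_curl \<Omega> v w}"

definition H_div :: "(real^3) set \<Rightarrow> (real^3 \<Rightarrow> real^3) set" where
  "H_div \<Omega> = {v. \<exists>d. is_weak_div \<Omega> v d}"

section \<open>Traces\<close>

text \<open>The boundary traces are the functionals given by Green's formulas, acting on fields \<open>\<phi>\<close> that are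
  smooth up to the boundary. With the unit outer normal \<open>n\<close>, they represent the boundary integrals
  of $v\,(\phi\cdot n)$, of $(v\times n)\cdot\phi$, and of $(v\cdot n)\,\phi$, respectively.\<close>

definition trace_grad :: "(real^3) set \<Rightarrow> (real^3 \<Rightarrow> real) \<Rightarrow> (real^3 \<Rightarrow> real^3) \<Rightarrow> real" where
  "trace_grad \<Omega> v \<phi> = l2_inner \<Omega> v (classical_div \<phi>) + l2_inner \<Omega> (weak_grad \<Omega> v) \<phi>"

definition trace_curl :: "(real^3) set \<Rightarrow> (real^3 \<Rightarrow> real^3) \<Rightarrow> (real^3 \<Rightarrow> real^3) \<Rightarrow> real" where
  "trace_curl \<Omega> v \<phi> = l2_inner \<Omega> v (classical_curl \<phi>) - l2_inner \<Omega> (weak_curl \<Omega> v) \<phi>"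

definition trace_div :: "(real^3) set \<Rightarrow> (real^3 \<Rightarrow> real^3) \<Rightarrow> (real^3 \<Rightarrow> real) \<Rightarrow> real" where
  "trace_div \<Omega> v \<phi> = l2_inner \<Omega> v (classical_grad \<phi>) + l2_inner \<Omega> (weak_div \<Omega> v) \<phi>"

definition H0_grad :: "(real^3) set \<Rightarrow> (real^3 \<Rightarrow> real) set" where
  "H0_grad \<Omega> = {v \<in> H_grad \<Omega>. \<forall>\<phi>. smooth \<phi> \<longrightarrow> trace_grad \<Omega> v \<phi> = 0}"

definition H0_curl :: "(real^3) set \<Rightarrow> (real^3 \<Rightarrow> real^3) set" where
  "H0_curl \<Omega> = {v \<in> H_curl \<Omega>. \<forall>\<phi>. smooth \<phi> \<longrightarrow> trace_curl \<Omega> v \<phi> = 0}"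

definition H0_div :: "(real^3) set \<Rightarrow> (real^3 \<Rightarrow> real^3) set" where
  "H0_div \<Omega> = {v \<in> H_div \<Omega>. \<forall>\<phi>. smooth \<phi> \<longrightarrow> trace_div \<Omega> v \<phi> = 0}"

section \<open>Finite element spaces\<close>

text \<open>A mesh is a finite family of disjoint open cells that cover \<open>\<Omega>\<close> up to a null set; no particular
  shape of the cells is prescribed.\<close>

definition mesh :: "(real^3) set \<Rightarrow> (real^3) set set \<Rightarrow> bool" where
  "mesh \<Omega> \<T> \<longleftrightarrow> finite \<T> \<and> disjoint \<T> \<and>
     (\<forall>K\<in>\<T>. open K \<and> K \<noteq> {} \<and> K \<subseteq> \<Omega>) \<and> negligible (\<Omega> - \<Union>\<T>)"

definition piecewise_polynomial :: "(real^3) set set \<Rightarrow> (real^3 \<Rightarrow> 'b::euclidean_space) \<Rightarrow> bool" where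
  "piecewise_polynomial \<T> v \<longleftrightarrow>
     (\<forall>K\<in>\<T>. \<exists>p. polynomial_function p \<and> (AE x in lebesgue_on K. v x = p x))"

text \<open>Subspaces of $L^2$ are sets of representatives closed under almost-everywhere equality, so that
  they correspond exactly to subspaces of the quotient. The dimension is that of the quotient.\<close>

definition fe_space :: "(real^3) set \<Rightarrow> (real^3) set set \<Rightarrow> (real^3 \<Rightarrow> 'b::euclidean_space) set \<Rightarrow> bool" where
  "fe_space \<Omega> \<T> V \<longleftrightarrow>
     V \<subseteq> L2 \<Omega> \<and>
     (\<lambda>x. 0) \<in> V \<and>
     (\<forall>u\<in>V. \<forall>v\<in>V. (\<lambda>x. u x + v x) \<in> V) \<and>
     (\<forall>a. \<forall>u\<in>V. (\<lambda>x. a *\<^sub>R u x) \<in> V) \<and>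
     (\<forall>u\<in>V. \<forall>v. l2_eq \<Omega> u v \<longrightarrow> v \<in> V) \<and>
     (\<exists>B. finite B \<and> B \<subseteq> V \<and> (\<forall>v\<in>V. \<exists>a. l2_eq \<Omega> v (\<lambda>x. \<Sum>b\<in>B. a b *\<^sub>R b x))) \<and>
     (\<forall>v\<in>V. piecewise_polynomial \<T> v)"

definition exact_discrete_de_rham ::
  "(real^3) set \<Rightarrow> (real^3) set set \<Rightarrow> (real^3 \<Rightarrow> real) set \<Rightarrow> (real^3 \<Rightarrow> real^3) set \<Rightarrow>
   (real^3 \<Rightarrow> real^3) set \<Rightarrow> (real^3 \<Rightarrow> real) set \<Rightarrow> bool" where
  "exact_discrete_de_rham \<Omega> \<T> Vg Vc Vd V0 \<longleftrightarrow>
     fe_space \<Omega> \<T> Vg \<and> Vg \<subseteq> H0_grad \<Omega> \<and>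
     fe_space \<Omega> \<T> Vc \<and> Vc \<subseteq> H0_curl \<Omega> \<and>
     fe_space \<Omega> \<T> Vd \<and> Vd \<subseteq> H0_div \<Omega> \<and>
     fe_space \<Omega> \<T> V0 \<and> V0 \<subseteq> L2_mean_zero \<Omega> \<and>
     (\<forall>q\<in>Vg. weak_grad \<Omega> q \<in> Vc) \<and>
     (\<forall>v\<in>Vc. weak_curl \<Omega> v \<in> Vd) \<and>
     (\<forall>C\<in>Vd. weak_div \<Omega> C \<in> V0) \<and>
     (\<forall>q\<in>Vg. l2_eq \<Omega> (weak_grad \<Omega> q) (\<lambda>x. 0) \<longrightarrow> l2_eq \<Omega> q (\<lambda>x. 0)) \<and>
     (\<forall>v\<in>Vc. l2_eq \<Omega> (weak_curl \<Omega> v) (\<lambda>x. 0) \<longleftrightarrow> (\<exists>q\<in>Vg. l2_eq \<Omega> v (weak_grad \<Omega> q))) \<and>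
     (\<forall>C\<in>Vd. l2_eq \<Omega> (weak_div \<Omega> C) (\<lambda>x. 0) \<longleftrightarrow> (\<exists>v\<in>Vc. l2_eq \<Omega> C (weak_curl \<Omega> v))) \<and>
     (\<forall>r\<in>V0. \<exists>C\<in>Vd. l2_eq \<Omega> r (weak_div \<Omega> C))"

section \<open>Discrete operators\<close>

text \<open>The defining variational problems determine these up to null sets.\<close>

definition disc_curl ::
  "(real^3) set \<Rightarrow> (real^3 \<Rightarrow> real^3) set \<Rightarrow> (real^3 \<Rightarrow> real^3) \<Rightarrow> real^3 \<Rightarrow> real^3" where
  "disc_curl \<Omega> Vc U =
     (SOME W. W \<in> Vc \<and> (\<forall>V\<in>Vc. l2_inner \<Omega> W V = l2_inner \<Omega> U (weak_curl \<Omega> V)))"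

definition disc_div ::
  "(real^3) set \<Rightarrow> (real^3 \<Rightarrow> real) set \<Rightarrow> (real^3 \<Rightarrow> real^3) \<Rightarrow> real^3 \<Rightarrow> real" where
  "disc_div \<Omega> Vg v =
     (SOME d. d \<in> Vg \<and> (\<forall>\<phi>\<in>Vg. l2_inner \<Omega> d \<phi> = - l2_inner \<Omega> v (weak_grad \<Omega> \<phi>)))"

definition poincare_constant ::
  "(real^3) set \<Rightarrow> (real^3 \<Rightarrow> real) set \<Rightarrow> (real^3 \<Rightarrow> real^3) set \<Rightarrow> real \<Rightarrow> bool" where
  "poincare_constant \<Omega> Vg Vc c_p \<longleftrightarrow>
     (\<forall>w\<in>Vc. l2_eq \<Omega> (disc_div \<Omega> Vg w) (\<lambda>x. 0) \<longrightarrow>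
        l2_norm \<Omega> w \<le> c_p * l2_norm \<Omega> (weak_curl \<Omega> w))"

section \<open>The scheme\<close>

text \<open>The value \<open>\<infinity>\<close> is allowed for Reynolds numbers, with reciprocal \<open>0\<close>.\<close>

definition recip :: "ereal \<Rightarrow> real" where
  "recip R = real_of_ereal (inverse R)"

definition time_diff :: "real \<Rightarrow> (nat \<Rightarrow> real^3 \<Rightarrow> real^3) \<Rightarrow> nat \<Rightarrow> real^3 \<Rightarrow> real^3" where
  "time_diff \<Delta>t u n x = (u (Suc n) x - u n x) /\<^sub>R \<Delta>t"

definition midpoint_val :: "(nat \<Rightarrow> real^3 \<Rightarrow> real^3) \<Rightarrow> nat \<Rightarrow> real^3 \<Rightarrow> real^3" where
  "midpoint_val u n x = (u (Suc n) x + u n x) /\<^sub>R 2"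

definition midpoint_source :: "real \<Rightarrow> (real \<Rightarrow> real^3 \<Rightarrow> real^3) \<Rightarrow> nat \<Rightarrow> real^3 \<Rightarrow> real^3" where
  "midpoint_source \<Delta>t f n = f ((real n + 1/2) * \<Delta>t)"

text \<open>In the sequences \<open>\<omega>\<close>, \<open>j\<close>, \<open>E\<close>, \<open>H\<close>, \<open>P\<close> the index \<open>n\<close> stands for the time level $n+1/2$.\<close>

definition mhd_scheme ::
  "(real^3) set \<Rightarrow> (real^3 \<Rightarrow> real) set \<Rightarrow> (real^3 \<Rightarrow> real^3) set \<Rightarrow> (real^3 \<Rightarrow> real^3) set \<Rightarrow>
   real \<Rightarrow> real \<Rightarrow> ereal \<Rightarrow> ereal \<Rightarrow> (real \<Rightarrow> real^3 \<Rightarrow> real^3) \<Rightarrow>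
   (nat \<Rightarrow> real^3 \<Rightarrow> real^3) \<Rightarrow> (nat \<Rightarrow> real^3 \<Rightarrow> real^3) \<Rightarrow> (nat \<Rightarrow> real^3 \<Rightarrow> real^3) \<Rightarrow>
   (nat \<Rightarrow> real^3 \<Rightarrow> real^3) \<Rightarrow> (nat \<Rightarrow> real^3 \<Rightarrow> real^3) \<Rightarrow> (nat \<Rightarrow> real^3 \<Rightarrow> real^3) \<Rightarrow>
   (nat \<Rightarrow> real^3 \<Rightarrow> real) \<Rightarrow> bool" where
  "mhd_scheme \<Omega> Vg Vc Vd \<Delta>t c R_e R_m f u B \<omega> j E H P \<longleftrightarrow>
     (\<forall>n. u n \<in> Vc \<and> B n \<in> Vd \<and> \<omega> n \<in> Vc \<and> j n \<in> Vc \<and> E n \<in> Vc \<and> H n \<in> Vc \<and> P n \<in> Vg) \<and>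
     (\<forall>n.
       (let u_h = midpoint_val u n; B_h = midpoint_val B n;
            Du = time_diff \<Delta>t u n; DB = time_diff \<Delta>t B n;
            \<omega>_h = \<omega> n; j_h = j n; E_h = E n; H_h = H n; P_h = P n;
            f_h = midpoint_source \<Delta>t f n
        in
        (\<forall>v\<in>Vc. l2_inner \<Omega> Du v
                - l2_inner \<Omega> (\<lambda>x. cross3 (u_h x) (\<omega>_h x)) v
                + recip R_e * l2_inner \<Omega> (weak_curl \<Omega> u_h) (weak_curl \<Omega> v)
                + l2_inner \<Omega> (weak_grad \<Omega> P_h) v
                - c * l2_inner \<Omega> (\<lambda>x. cross3 (j_h x) (H_h x)) v
              = l2_inner \<Omega> f_h v) \<and>
        (\<forall>C\<in>Vd. l2_inner \<Omega> DB C + l2_inner \<Omega> (weak_curl \<Omega> E_h) C = 0) \<and>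
        (\<forall>G\<in>Vc. l2_inner \<Omega>
                (\<lambda>x. recip R_m *\<^sub>R j_h x - (E_h x + cross3 (u_h x) (H_h x))) G = 0) \<and>
        (\<forall>\<mu>\<in>Vc. l2_inner \<Omega> \<omega>_h \<mu> - l2_inner \<Omega> (weak_curl \<Omega> u_h) \<mu> = 0) \<and>
        (\<forall>k\<in>Vc. l2_inner \<Omega> j_h k - l2_inner \<Omega> B_h (weak_curl \<Omega> k) = 0) \<and>
        (\<forall>F\<in>Vc. l2_inner \<Omega> B_h F - l2_inner \<Omega> H_h F = 0) \<and>
        (\<forall>Q\<in>Vg. l2_inner \<Omega> u_h (weak_grad \<Omega> Q) = 0)))"

end

theory Submission
  imports Defs
begin

text \<open>
  The energy law is the result of testing each equation with the midpoint unknown to which it is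
  energetically dual: momentum with \<open>u\<close>, Faraday's law with \<open>B\<close>, Ohm's law with \<open>j\<close>, and the weak
  Ampere law with \<open>E\<close>. The convective term vanishes because \<open>(u \<times> \<omega>) \<bullet> u = 0\<close> pointwise, and the
  pressure term by the discrete divergence constraint. The Lorentz force does the work
  \<open>(j \<times> H) \<bullet> u = - (u \<times> H) \<bullet> j\<close>, which Ohm's law turns into \<open>(E, j)\<close> minus the Joule heating. Ampere's law
  and Faraday's law rewrite \<open>(E, j)\<close> as \<open>(curl E, B) = - (D\<^sub>t B, B)\<close>, so the exchange between kinetic
  and magnetic energy cancels.

  The one analytic point is that Ohm's law contains a product of three fields, which for general
  $L^2$ fields need not be integrable, and then its integral could not be split into parts. Piecewise
  polynomials on a bounded domain are essentially bounded, which makes the product integrable.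

  For the stability estimate, \<open>(D\<^sub>t u, u)\<close> with the midpoint value \<open>u\<close> is an exact difference quotient
  of \<open>\<parallel>u\<parallel>\<^sup>2 / 2\<close>, so the energy law telescopes. The work of the source is bounded by the inequalities
  of Cauchy-Schwarz, Poincare and Young, and half of the viscous dissipation absorbs the result.
  The Poincare inequality applies since the velocity has zero discrete divergence, and \<open>j\<close> has the
  norm of the discrete curl of \<open>B\<close> since Ampere's law is the variational problem that defines this
  discrete curl.
\<close>

section \<open>The $L^2$ inner product\<close>

lemma integrable_inner_L2:
  assumes "u \<in> L2 \<Omega>" and "v \<in> L2 \<Omega>"
  shows "integrable (lebesgue_on \<Omega>) (\<lambda>x. u x \<bullet> v x)"
proof (rule Bochner_Integration.integrable_bound)
  show "integrable (lebesgue_on \<Omega>) (\<lambda>x. (norm (u x))\<^sup>2 + (norm (v x))\<^sup>2)"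
    using assms unfolding L2_def by simp
  show "(\<lambda>x. u x \<bullet> v x) \<in> borel_measurable (lebesgue_on \<Omega>)"
    using assms unfolding L2_def by (intro borel_measurable_inner) auto
  show "AE x in lebesgue_on \<Omega>. norm (u x \<bullet> v x) \<le> norm ((norm (u x))\<^sup>2 + (norm (v x))\<^sup>2)"
  proof (intro always_eventually allI)
    fix x
    have "\<bar>u x \<bullet> v x\<bar> \<le> norm (u x) * norm (v x)"
      by (rule Cauchy_Schwarz_ineq2)
    also have "\<dots> \<le> (norm (u x))\<^sup>2 + (norm (v x))\<^sup>2"
      using sum_squares_bound[of "norm (u x)" "norm (v x)"]
        mult_nonneg_nonneg[OF norm_ge_zero[of "u x"] norm_ge_zero[of "v x"]] by linarith
    finally show "norm (u x \<bullet> v x) \<le> norm ((norm (u x))\<^sup>2 + (norm (v x))\<^sup>2)"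
      by simp
  qed
qed

lemma l2_inner_commute: "l2_inner \<Omega> u v = l2_inner \<Omega> v u"
  unfolding l2_inner_def by (simp add: inner_commute)

lemma l2_inner_self_nonneg: "0 \<le> l2_inner \<Omega> u u"
  unfolding l2_inner_def by (simp add: integral_nonneg_AE)

lemma l2_norm_nonneg: "0 \<le> l2_norm \<Omega> u"
  unfolding l2_norm_def using l2_inner_self_nonneg by simp

lemma l2_norm_sq: "(l2_norm \<Omega> u)\<^sup>2 = l2_inner \<Omega> u u"
  unfolding l2_norm_def using l2_inner_self_nonneg by simp

lemma l2_eq_zero_if_inner_self_zero:
  assumes "u \<in> L2 \<Omega>" and "l2_inner \<Omega> u u = 0"
  shows "l2_eq \<Omega> u (\<lambda>x. 0)"
proof -
  have "AE x in lebesgue_on \<Omega>. u x \<bullet> u x = 0"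
    using integral_nonneg_eq_0_iff_AE[OF integrable_inner_L2[OF assms(1,1)]] assms(2)
    unfolding l2_inner_def by simp
  then show ?thesis
    unfolding l2_eq_def by simp
qed

lemma l2_cauchy_schwarz:
  assumes "u \<in> L2 \<Omega>" and "v \<in> L2 \<Omega>"
  shows "l2_inner \<Omega> u v \<le> l2_norm \<Omega> u * l2_norm \<Omega> v"
proof -
  let ?a = "l2_inner \<Omega> u u" and ?b = "l2_inner \<Omega> v v" and ?d = "l2_inner \<Omega> u v"
  have quad: "0 \<le> ?a - 2 * t * ?d + t\<^sup>2 * ?b" for t
  proof -
    have "0 \<le> l2_inner \<Omega> (\<lambda>x. u x - t *\<^sub>R v x) (\<lambda>x. u x - t *\<^sub>R v x)"
      by (rule l2_inner_self_nonneg)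
    also have "\<dots> = integral\<^sup>L (lebesgue_on \<Omega>)
        (\<lambda>x. u x \<bullet> u x - 2 * t * (u x \<bullet> v x) + t\<^sup>2 * (v x \<bullet> v x))"
      unfolding l2_inner_def
      by (rule Bochner_Integration.integral_cong)
        (simp_all add: inner_diff_left inner_diff_right inner_commute power2_eq_square algebra_simps)
    also have "\<dots> = ?a - 2 * t * ?d + t\<^sup>2 * ?b"
      unfolding l2_inner_def using assms by (simp add: integrable_inner_L2)
    finally show ?thesis .
  qed
  have "?d\<^sup>2 \<le> ?a * ?b"
  proof (cases "?b = 0")
    case True
    have "?d = 0"
    proof (rule ccontr)
      assume "?d \<noteq> 0"
      \<comment> \<open>The quadratic has become affine in \<open>t\<close>; here it takes the value \<open>-1\<close>.\<close>
      then show False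
        using quad[of "(?a + 1) / (2 * ?d)"] True by simp
    qed
    then show ?thesis
      using True by simp
  next
    case False
    then have "0 < ?b"
      using l2_inner_self_nonneg[of \<Omega> v] by simp
    \<comment> \<open>The minimum of the quadratic lies at \<open>t = ?d / ?b\<close>.\<close>
    then show ?thesis
      using quad[of "?d / ?b"] by (simp add: field_simps power2_eq_square)
  qed
  also have "\<dots> = (l2_norm \<Omega> u * l2_norm \<Omega> v)\<^sup>2"
    by (simp add: power_mult_distrib l2_norm_sq)
  finally show ?thesis
    by (rule power2_le_imp_le) (intro mult_nonneg_nonneg l2_norm_nonneg)
qed

text \<open>Averaging the two time levels is what makes the product rule for \<open>\<parallel>w\<parallel>\<^sup>2\<close> exact in discrete time.\<close>

lemma l2_inner_time_diff_midpoint: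
  assumes "w n \<in> L2 \<Omega>" and "w (Suc n) \<in> L2 \<Omega>" and "\<Delta>t \<noteq> 0"
  shows "\<Delta>t * l2_inner \<Omega> (time_diff \<Delta>t w n) (midpoint_val w n)
    = 1/2 * ((l2_norm \<Omega> (w (Suc n)))\<^sup>2 - (l2_norm \<Omega> (w n))\<^sup>2)"
proof -
  have "l2_inner \<Omega> (time_diff \<Delta>t w n) (midpoint_val w n) = integral\<^sup>L (lebesgue_on \<Omega>)
      (\<lambda>x. 1 / (2 * \<Delta>t) * (w (Suc n) x \<bullet> w (Suc n) x - w n x \<bullet> w n x))"
    unfolding l2_inner_def time_diff_def midpoint_val_def
    by (rule Bochner_Integration.integral_cong)
      (simp_all add: inner_diff_left inner_diff_right inner_add_left inner_add_right
        inner_commute field_simps diff_divide_distrib)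
  also have "\<dots> = 1 / (2 * \<Delta>t) *
      ((l2_norm \<Omega> (w (Suc n)))\<^sup>2 - (l2_norm \<Omega> (w n))\<^sup>2)"
    unfolding l2_norm_sq l2_inner_def using assms by (simp add: integrable_inner_L2)
  finally show ?thesis
    using assms(3) by simp
qed

section \<open>Piecewise polynomial fields\<close>

text \<open>A polynomial is bounded on the closure of a bounded cell, and there are only finitely many cells.\<close>

lemma piecewise_polynomial_essentially_bounded:
  fixes v :: "real^3 \<Rightarrow> 'b::euclidean_space"
  assumes "open \<Omega>" and "bounded \<Omega>" and "mesh \<Omega> \<T>" and "piecewise_polynomial \<T> v"
  obtains M where "AE x in lebesgue_on \<Omega>. norm (v x) \<le> M"
proof -
  have fin: "finite \<T>" and cell: "\<And>K. K \<in> \<T> \<Longrightarrow> open K \<and> K \<subseteq> \<Omega>"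
    and null: "negligible (\<Omega> - \<Union>\<T>)"
    using assms(3) unfolding mesh_def by auto
  have "\<exists>M. AE x in lebesgue. x \<in> K \<longrightarrow> norm (v x) \<le> M" if K: "K \<in> \<T>" for K
  proof -
    obtain p where p: "polynomial_function p" and eq: "AE x in lebesgue_on K. v x = p x"
      using assms(4) K unfolding piecewise_polynomial_def by blast
    have "compact (closure K)"
      using cell[OF K] assms(2) by (simp add: bounded_subset)
    then have "bounded (p ` closure K)"
      using p by (intro compact_imp_bounded compact_continuous_image
          continuous_on_polymonial_function)
    then obtain M where M: "\<And>x. x \<in> closure K \<Longrightarrow> norm (p x) \<le> M"
      unfolding bounded_iff by auto
    have "AE x in lebesgue. x \<in> K \<longrightarrow> v x = p x"
      using eq cell[OF K] by (simp add: AE_restrict_space_iff)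
    then have "AE x in lebesgue. x \<in> K \<longrightarrow> norm (v x) \<le> M"
      by (rule AE_mp) (use M closure_subset in auto)
    then show ?thesis ..
  qed
  then have "\<forall>K\<in>\<T>. \<exists>M. AE x in lebesgue. x \<in> K \<longrightarrow> norm (v x) \<le> M" ..
  from bchoice[OF this] obtain M
    where "\<forall>K\<in>\<T>. AE x in lebesgue. x \<in> K \<longrightarrow> norm (v x) \<le> M K" ..
  then have bound: "AE x in lebesgue. \<forall>K\<in>\<T>. x \<in> K \<longrightarrow> norm (v x) \<le> M K"
    using fin by (intro AE_finite_allI) blast+
  have cover: "AE x in lebesgue. x \<notin> \<Omega> - \<Union>\<T>"
    using null by (intro AE_not_in) (simp add: negligible_iff_null_sets)
  have "AE x in lebesgue. x \<in> \<Omega> \<longrightarrow> norm (v x) \<le> (\<Sum>K\<in>\<T>. \<bar>M K\<bar>)"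
    using bound cover
  proof eventually_elim
    case (elim x)
    show ?case
    proof
      assume "x \<in> \<Omega>"
      with elim obtain K where "K \<in> \<T>" and "norm (v x) \<le> M K"
        by auto
      moreover have "\<bar>M K\<bar> \<le> (\<Sum>K\<in>\<T>. \<bar>M K\<bar>)"
        using fin \<open>K \<in> \<T>\<close> by (intro member_le_sum) auto
      ultimately show "norm (v x) \<le> (\<Sum>K\<in>\<T>. \<bar>M K\<bar>)"
        by linarith
    qed
  qed
  then have "AE x in lebesgue_on \<Omega>. norm (v x) \<le> (\<Sum>K\<in>\<T>. \<bar>M K\<bar>)"
    using assms(1) by (simp add: AE_restrict_space_iff)
  then show thesis ..
qed

lemma norm_cross3_le: "norm (cross3 a b) \<le> norm a * norm b"
proof (rule power2_le_imp_le)
  show "(norm (cross3 a b))\<^sup>2 \<le> (norm a * norm b)\<^sup>2"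
    using norm_cross_dot[of a b] zero_le_power2[of "a \<bullet> b"] by linarith
qed simp

text \<open>One essentially bounded factor reduces the triple product to a product of two $L^2$ fields.\<close>

lemma integrable_triple_product:
  assumes "a \<in> L2 \<Omega>" and "b \<in> L2 \<Omega>" and "d \<in> L2 \<Omega>"
    and bound: "AE x in lebesgue_on \<Omega>. norm (a x) \<le> M"
  shows "integrable (lebesgue_on \<Omega>) (\<lambda>x. cross3 (a x) (b x) \<bullet> d x)"
proof (rule Bochner_Integration.integrable_bound)
  show "integrable (lebesgue_on \<Omega>) (\<lambda>x. M * ((norm (b x))\<^sup>2 + (norm (d x))\<^sup>2))"
    using assms unfolding L2_def by simp
  have "(\<lambda>x. cross3 (a x) (b x)) \<in> borel_measurable (lebesgue_on \<Omega>)"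
    using assms(1,2) unfolding L2_def
    by (intro borel_measurable_continuous_Pair[where H = cross3] continuous_on_cross
        continuous_on_fst continuous_on_snd continuous_on_id) auto
  then show "(\<lambda>x. cross3 (a x) (b x) \<bullet> d x) \<in> borel_measurable (lebesgue_on \<Omega>)"
    using assms(3) unfolding L2_def by (intro borel_measurable_inner) auto
  show "AE x in lebesgue_on \<Omega>. norm (cross3 (a x) (b x) \<bullet> d x)
      \<le> norm (M * ((norm (b x))\<^sup>2 + (norm (d x))\<^sup>2))"
    using bound
  proof eventually_elim
    case (elim x)
    have "0 \<le> M"
      using elim norm_ge_zero[of "a x"] by linarith
    have "\<bar>cross3 (a x) (b x) \<bullet> d x\<bar> \<le> norm (cross3 (a x) (b x)) * norm (d x)"
      by (rule Cauchy_Schwarz_ineq2)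
    also have "\<dots> \<le> (norm (a x) * norm (b x)) * norm (d x)"
      by (intro mult_right_mono norm_cross3_le norm_ge_zero)
    also have "\<dots> \<le> (M * norm (b x)) * norm (d x)"
      using elim by (intro mult_right_mono) auto
    also have "\<dots> = M * (norm (b x) * norm (d x))"
      by simp
    also have "\<dots> \<le> M * ((norm (b x))\<^sup>2 + (norm (d x))\<^sup>2)"
      using sum_squares_bound[of "norm (b x)" "norm (d x)"] \<open>0 \<le> M\<close>
        mult_nonneg_nonneg[OF norm_ge_zero[of "b x"] norm_ge_zero[of "d x"]]
      by (intro mult_left_mono) linarith+
    finally show ?case
      by simp
  qed
qed

section \<open>The discrete operators\<close>

text \<open>Both \<open>W\<close> and the chosen discrete curl solve the same variational problem; testing each of the two
  problems with the other solution identifies the norms.\<close>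

lemma l2_norm_disc_curl:
  assumes "W \<in> Vc" and "\<forall>V\<in>Vc. l2_inner \<Omega> W V = l2_inner \<Omega> U (weak_curl \<Omega> V)"
  shows "l2_norm \<Omega> (disc_curl \<Omega> Vc U) = l2_norm \<Omega> W"
proof -
  let ?D = "disc_curl \<Omega> Vc U"
  have D: "?D \<in> Vc \<and> (\<forall>V\<in>Vc. l2_inner \<Omega> ?D V = l2_inner \<Omega> U (weak_curl \<Omega> V))"
    unfolding disc_curl_def by (rule someI[of _ W]) (use assms in auto)
  have "l2_inner \<Omega> ?D ?D = l2_inner \<Omega> W ?D"
    using D assms by simp
  also have "\<dots> = l2_inner \<Omega> ?D W"
    by (rule l2_inner_commute)
  also have "\<dots> = l2_inner \<Omega> W W"
    using D assms by simp
  finally show ?thesis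
    unfolding l2_norm_def by simp
qed

text \<open>The zero function shows that the variational problem has a solution, and testing the chosen
  solution with itself shows that it has norm zero.\<close>

lemma disc_div_eq_zero:
  assumes "Vg \<subseteq> L2 \<Omega>" and "(\<lambda>x. 0) \<in> Vg" and "\<forall>Q\<in>Vg. l2_inner \<Omega> v (weak_grad \<Omega> Q) = 0"
  shows "l2_eq \<Omega> (disc_div \<Omega> Vg v) (\<lambda>x. 0)"
proof -
  let ?d = "disc_div \<Omega> Vg v"
  have d: "?d \<in> Vg \<and> (\<forall>\<phi>\<in>Vg. l2_inner \<Omega> ?d \<phi> = - l2_inner \<Omega> v (weak_grad \<Omega> \<phi>))"
    unfolding disc_div_def
    by (rule someI[of _ "\<lambda>x. 0"]) (use assms in \<open>auto simp: l2_inner_def\<close>)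
  then have "l2_inner \<Omega> ?d ?d = 0"
    using assms(3) by simp
  then show ?thesis
    using d assms(1) by (intro l2_eq_zero_if_inner_self_zero) auto
qed

lemma fe_space_midpoint:
  assumes "fe_space \<Omega> \<T> V" and "w n \<in> V" and "w (Suc n) \<in> V"
  shows "midpoint_val w n \<in> V"
proof -
  have add: "\<forall>u\<in>V. \<forall>v\<in>V. (\<lambda>x. u x + v x) \<in> V"
    and scale: "\<forall>a. \<forall>u\<in>V. (\<lambda>x. a *\<^sub>R u x) \<in> V"
    using assms(1) unfolding fe_space_def by simp_all
  have "(\<lambda>x. inverse 2 *\<^sub>R (w (Suc n) x + w n x)) \<in> V"
    using scale[rule_format, OF add[rule_format, OF assms(3,2)]] .
  moreover have "midpoint_val w n = (\<lambda>x. inverse 2 *\<^sub>R (w (Suc n) x + w n x))"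
    by (simp add: fun_eq_iff midpoint_val_def)
  ultimately show ?thesis
    by simp
qed

section \<open>Energy law and stability\<close>

text \<open>The hypotheses are the scheme at one time level, after the choice of test functions: \<open>du\<close> and
  \<open>dB\<close> are the difference quotients, \<open>u\<close> and \<open>B\<close> the midpoint values, \<open>p\<close> is the
  pressure gradient, \<open>g\<close> the source, and \<open>r\<close> and \<open>s\<close> are the reciprocal fluid and magnetic Reynolds
  numbers.\<close>

lemma energy_balance:
  assumes L2: "u \<in> L2 \<Omega>" "j \<in> L2 \<Omega>" "E \<in> L2 \<Omega>" "H \<in> L2 \<Omega>"
    and bound: "AE x in lebesgue_on \<Omega>. norm (u x) \<le> M"
    and momentum: "l2_inner \<Omega> du u - l2_inner \<Omega> (\<lambda>x. cross3 (u x) (\<omega> x)) u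
        + r * l2_inner \<Omega> curlu curlu + l2_inner \<Omega> p u
        - c * l2_inner \<Omega> (\<lambda>x. cross3 (j x) (H x)) u = l2_inner \<Omega> g u"
    and faraday: "l2_inner \<Omega> dB B + l2_inner \<Omega> curlE B = 0"
    and ohm: "l2_inner \<Omega> (\<lambda>x. s *\<^sub>R j x - (E x + cross3 (u x) (H x))) j = 0"
    and ampere: "l2_inner \<Omega> j E = l2_inner \<Omega> B curlE"
    and solenoidal: "l2_inner \<Omega> u p = 0"
  shows "l2_inner \<Omega> du u + c * l2_inner \<Omega> dB B + r * (l2_norm \<Omega> curlu)\<^sup>2
      + c * s * (l2_norm \<Omega> j)\<^sup>2 = l2_inner \<Omega> g u"
proof -
  have convective: "l2_inner \<Omega> (\<lambda>x. cross3 (u x) (\<omega> x)) u = 0"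
    unfolding l2_inner_def by (simp add: dot_cross_self)
  have pressure: "l2_inner \<Omega> p u = 0"
    using solenoidal l2_inner_commute by metis
  have triple: "cross3 a b \<bullet> d = - (cross3 d b \<bullet> a)" for a b d
    by (simp add: cross3_simps)
  have lorentz: "l2_inner \<Omega> (\<lambda>x. cross3 (j x) (H x)) u
      = - l2_inner \<Omega> (\<lambda>x. cross3 (u x) (H x)) j"
    unfolding l2_inner_def by (subst triple) simp
  have "l2_inner \<Omega> (\<lambda>x. s *\<^sub>R j x - (E x + cross3 (u x) (H x))) j = integral\<^sup>L (lebesgue_on \<Omega>)
      (\<lambda>x. s * (j x \<bullet> j x) - (E x \<bullet> j x + cross3 (u x) (H x) \<bullet> j x))"
    unfolding l2_inner_def by (simp add: inner_diff_left inner_add_left)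
  also have "\<dots> = s * l2_inner \<Omega> j j
      - (l2_inner \<Omega> E j + l2_inner \<Omega> (\<lambda>x. cross3 (u x) (H x)) j)"
    unfolding l2_inner_def
    using L2 integrable_triple_product[OF L2(1,4,2) bound] by (simp add: integrable_inner_L2)
  finally have joule: "l2_inner \<Omega> (\<lambda>x. cross3 (u x) (H x)) j
      = s * l2_inner \<Omega> j j - l2_inner \<Omega> E j"
    using ohm by simp
  have exchange: "l2_inner \<Omega> E j = - l2_inner \<Omega> dB B"
    using faraday ampere l2_inner_commute[of \<Omega> E j] l2_inner_commute[of \<Omega> curlE B] by linarith
  show ?thesis
    using momentum unfolding convective pressure lorentz joule exchange l2_norm_sq
    by (simp add: algebra_simps)
qed

text \<open>Young's inequality with the weight \<open>R\<close> balances the two factors so that exactly half of the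
  dissipation \<open>K\<^sup>2 / R\<close> is used up.\<close>

lemma work_absorbed_by_dissipation:
  fixes F K R w cp N :: real
  assumes "w \<le> F * N" and "N \<le> cp * K" and "0 \<le> F" and "0 < R"
  shows "w \<le> 1/2 * (1 / R) * K\<^sup>2 + 1/2 * cp\<^sup>2 * R * F\<^sup>2"
proof -
  have "w \<le> F * (cp * K)"
    using assms(1) mult_left_mono[OF assms(2,3)] by linarith
  also have "F * (cp * K) \<le> 1/2 * (1 / R) * K\<^sup>2 + 1/2 * cp\<^sup>2 * R * F\<^sup>2"
  proof -
    have "0 \<le> 1/2 * (1 / R) * (K - R * cp * F)\<^sup>2"
      using assms(4) by simp
    also have "\<dots> = 1/2 * (1 / R) * K\<^sup>2 + 1/2 * cp\<^sup>2 * R * F\<^sup>2 - F * (cp * K)"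
      using assms(4) by (simp add: power2_eq_square field_simps)
    finally show ?thesis
      by simp
  qed
  finally show ?thesis .
qed

lemma telescoped_bound:
  fixes e a :: "nat \<Rightarrow> real"
  assumes "\<And>k. e (Suc k) - e k \<le> a k"
  shows "e (Suc n) \<le> e 0 + (\<Sum>k=0..n. a k)"
proof (induction n)
  case 0
  show ?case
    using assms[of 0] by simp
next
  case (Suc n)
  then show ?case
    using assms[of "Suc n"] by simp
qed

theorem theorem4:
  fixes \<Omega> :: "(real^3) set" and \<T> :: "(real^3) set set"
    and Vg V0 :: "(real^3 \<Rightarrow> real) set" and Vc Vd :: "(real^3 \<Rightarrow> real^3) set"
    and \<Delta>t c :: real and R_e R_m :: ereal
    and f :: "real \<Rightarrow> real^3 \<Rightarrow> real^3"
    and u B \<omega> j E H :: "nat \<Rightarrow> real^3 \<Rightarrow> real^3" and P :: "nat \<Rightarrow> real^3 \<Rightarrow> real"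
  assumes "bounded_lipschitz_domain \<Omega>" and "contractible \<Omega>"
    and "mesh \<Omega> \<T>" and "exact_discrete_de_rham \<Omega> \<T> Vg Vc Vd V0"
    and "\<Delta>t > 0" and "c > 0" and "R_e > 0" and "R_m > 0"
    and "\<And>t. t \<ge> 0 \<Longrightarrow> f t \<in> L2 \<Omega>"
    and "mhd_scheme \<Omega> Vg Vc Vd \<Delta>t c R_e R_m f u B \<omega> j E H P"
  shows "(\<forall>n. l2_inner \<Omega> (time_diff \<Delta>t u n) (midpoint_val u n)
              + c * l2_inner \<Omega> (time_diff \<Delta>t B n) (midpoint_val B n)
              + recip R_e * (l2_norm \<Omega> (weak_curl \<Omega> (midpoint_val u n)))\<^sup>2
              + c * recip R_m * (l2_norm \<Omega> (j n))\<^sup>2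
            = l2_inner \<Omega> (midpoint_source \<Delta>t f n) (midpoint_val u n)) \<and>
         (\<forall>c_p. R_e \<noteq> \<infinity> \<and> poincare_constant \<Omega> Vg Vc c_p \<longrightarrow>
           (\<forall>n. 1/2 * ((l2_norm \<Omega> (u (Suc n)))\<^sup>2 + c * (l2_norm \<Omega> (B (Suc n)))\<^sup>2)
              \<le> 1/2 * ((l2_norm \<Omega> (u 0))\<^sup>2 + c * (l2_norm \<Omega> (B 0))\<^sup>2)
                - 1/2 * recip R_e *
                    (\<Sum>k=0..n. \<Delta>t * (l2_norm \<Omega> (weak_curl \<Omega> (midpoint_val u k)))\<^sup>2)
                - c * recip R_m *
                    (\<Sum>k=0..n. \<Delta>t * (l2_norm \<Omega> (disc_curl \<Omega> Vc (midpoint_val B k)))\<^sup>2)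
                + 1/2 * \<Delta>t * c_p\<^sup>2 * real_of_ereal R_e *
                    (\<Sum>k=0..n. (l2_norm \<Omega> (midpoint_source \<Delta>t f k))\<^sup>2)))"
proof -
  let ?u = "midpoint_val u" and ?B = "midpoint_val B" and ?f = "midpoint_source \<Delta>t f"
  have "open \<Omega>" and "bounded \<Omega>"
    using assms(1) unfolding bounded_lipschitz_domain_def by auto
  have Vg: "fe_space \<Omega> \<T> Vg" and Vc: "fe_space \<Omega> \<T> Vc" and Vd: "fe_space \<Omega> \<T> Vd"
    using assms(4) unfolding exact_discrete_de_rham_def by auto
  have L2_Vc: "Vc \<subseteq> L2 \<Omega>" and L2_Vd: "Vd \<subseteq> L2 \<Omega>"
    using Vc Vd unfolding fe_space_def by auto
  have mem: "u n \<in> Vc" "B n \<in> Vd" "j n \<in> Vc" "E n \<in> Vc" "H n \<in> Vc" "P n \<in> Vg" for n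
    using assms(10)[unfolded mhd_scheme_def, THEN conjunct1] by simp_all
  have mid_u: "?u n \<in> Vc" and mid_B: "?B n \<in> Vd" for n
    by (rule fe_space_midpoint[OF Vc mem(1) mem(1)], rule fe_space_midpoint[OF Vd mem(2) mem(2)])
  note scheme = assms(10)[unfolded mhd_scheme_def Let_def, THEN conjunct2, THEN spec]
  have scheme_a: "l2_inner \<Omega> (time_diff \<Delta>t u n) v
        - l2_inner \<Omega> (\<lambda>x. cross3 (?u n x) (\<omega> n x)) v
        + recip R_e * l2_inner \<Omega> (weak_curl \<Omega> (?u n)) (weak_curl \<Omega> v)
        + l2_inner \<Omega> (weak_grad \<Omega> (P n)) v
        - c * l2_inner \<Omega> (\<lambda>x. cross3 (j n x) (H n x)) v = l2_inner \<Omega> (?f n) v"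
    if "v \<in> Vc" for n v
    using scheme[of n, THEN conjunct1] that by (rule bspec)
  have scheme_b: "l2_inner \<Omega> (time_diff \<Delta>t B n) C + l2_inner \<Omega> (weak_curl \<Omega> (E n)) C = 0"
    if "C \<in> Vd" for n C
    using scheme[of n, THEN conjunct2, THEN conjunct1] that by (rule bspec)
  have scheme_c: "l2_inner \<Omega>
        (\<lambda>x. recip R_m *\<^sub>R j n x - (E n x + cross3 (?u n x) (H n x))) G = 0"
    if "G \<in> Vc" for n G
    using scheme[of n, THEN conjunct2, THEN conjunct2, THEN conjunct1] that by (rule bspec)
  have scheme_e: "l2_inner \<Omega> (j n) k = l2_inner \<Omega> (?B n) (weak_curl \<Omega> k)" if "k \<in> Vc" for n k
    using bspec[OF scheme[of n, THEN conjunct2, THEN conjunct2, THEN conjunct2, THEN conjunct2,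
        THEN conjunct1] that] by simp
  have scheme_g: "l2_inner \<Omega> (?u n) (weak_grad \<Omega> Q) = 0" if "Q \<in> Vg" for n Q
    using scheme[of n, THEN conjunct2, THEN conjunct2, THEN conjunct2, THEN conjunct2,
        THEN conjunct2, THEN conjunct2] that by (rule bspec)
  have energy: "l2_inner \<Omega> (time_diff \<Delta>t u n) (?u n) + c * l2_inner \<Omega> (time_diff \<Delta>t B n) (?B n)
      + recip R_e * (l2_norm \<Omega> (weak_curl \<Omega> (?u n)))\<^sup>2 + c * recip R_m * (l2_norm \<Omega> (j n))\<^sup>2
      = l2_inner \<Omega> (?f n) (?u n)" for n
  proof -
    have "piecewise_polynomial \<T> v" if "v \<in> Vc" for v
      using Vc that unfolding fe_space_def by simp
    from this[OF mid_u] obtain M where M: "AE x in lebesgue_on \<Omega>. norm (?u n x) \<le> M"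
      using piecewise_polynomial_essentially_bounded[OF \<open>open \<Omega>\<close> \<open>bounded \<Omega>\<close> assms(3)]
      by metis
    show ?thesis
      by (rule energy_balance[OF _ _ _ _ M scheme_a[OF mid_u] scheme_b[OF mid_B]
            scheme_c[OF mem(3)] scheme_e[OF mem(4)] scheme_g[OF mem(6)]])
        (intro subsetD[OF L2_Vc] mem mid_u)+
  qed
  have stability: "1/2 * ((l2_norm \<Omega> (u (Suc n)))\<^sup>2 + c * (l2_norm \<Omega> (B (Suc n)))\<^sup>2)
      \<le> 1/2 * ((l2_norm \<Omega> (u 0))\<^sup>2 + c * (l2_norm \<Omega> (B 0))\<^sup>2)
        - 1/2 * recip R_e * (\<Sum>k=0..n. \<Delta>t * (l2_norm \<Omega> (weak_curl \<Omega> (?u k)))\<^sup>2)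
        - c * recip R_m * (\<Sum>k=0..n. \<Delta>t * (l2_norm \<Omega> (disc_curl \<Omega> Vc (?B k)))\<^sup>2)
        + 1/2 * \<Delta>t * c_p\<^sup>2 * real_of_ereal R_e * (\<Sum>k=0..n. (l2_norm \<Omega> (?f k))\<^sup>2)"
    if "R_e \<noteq> \<infinity>" and poincare: "poincare_constant \<Omega> Vg Vc c_p" for c_p n
  proof -
    obtain R where R: "R_e = ereal R" and "0 < R"
      using assms(7) \<open>R_e \<noteq> \<infinity>\<close> by (cases R_e) auto
    then have recip: "recip R_e = 1 / R"
      by (simp add: recip_def inverse_eq_divide)
    define e where "e k = 1/2 * ((l2_norm \<Omega> (u k))\<^sup>2 + c * (l2_norm \<Omega> (B k))\<^sup>2)" for k
    define a where "a k = - (1/2 * (1 / R)) * (\<Delta>t * (l2_norm \<Omega> (weak_curl \<Omega> (?u k)))\<^sup>2)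
        - c * recip R_m * (\<Delta>t * (l2_norm \<Omega> (disc_curl \<Omega> Vc (?B k)))\<^sup>2)
        + 1/2 * \<Delta>t * c_p\<^sup>2 * R * (l2_norm \<Omega> (?f k))\<^sup>2" for k
    have step: "e (Suc k) - e k \<le> a k" for k
    proof -
      have "?f k \<in> L2 \<Omega>"
        unfolding midpoint_source_def using assms(5) by (intro assms(9)) simp
      then have cs: "l2_inner \<Omega> (?f k) (?u k) \<le> l2_norm \<Omega> (?f k) * l2_norm \<Omega> (?u k)"
        using mid_u L2_Vc by (intro l2_cauchy_schwarz) auto
      have "l2_eq \<Omega> (disc_div \<Omega> Vg (?u k)) (\<lambda>x. 0)"
        using Vg scheme_g unfolding fe_space_def by (intro disc_div_eq_zero) simp_all
      then have poincare_u: "l2_norm \<Omega> (?u k) \<le> c_p * l2_norm \<Omega> (weak_curl \<Omega> (?u k))"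
        using poincare mid_u unfolding poincare_constant_def by simp
      have work: "l2_inner \<Omega> (?f k) (?u k)
          \<le> 1/2 * (1 / R) * (l2_norm \<Omega> (weak_curl \<Omega> (?u k)))\<^sup>2
            + 1/2 * c_p\<^sup>2 * R * (l2_norm \<Omega> (?f k))\<^sup>2"
        by (rule work_absorbed_by_dissipation[OF cs poincare_u l2_norm_nonneg \<open>0 < R\<close>])
      have current: "l2_norm \<Omega> (disc_curl \<Omega> Vc (?B k)) = l2_norm \<Omega> (j k)"
        using scheme_e by (intro l2_norm_disc_curl mem) simp
      have "e (Suc k) - e k = \<Delta>t * l2_inner \<Omega> (time_diff \<Delta>t u k) (?u k)
          + c * (\<Delta>t * l2_inner \<Omega> (time_diff \<Delta>t B k) (?B k))"
        using mem L2_Vc L2_Vd assms(5)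
        by (subst (1 2) l2_inner_time_diff_midpoint) (auto simp: e_def algebra_simps)
      also have "\<dots> = \<Delta>t * (l2_inner \<Omega> (?f k) (?u k)
          - 1 / R * (l2_norm \<Omega> (weak_curl \<Omega> (?u k)))\<^sup>2 - c * recip R_m * (l2_norm \<Omega> (j k))\<^sup>2)"
        unfolding energy[of k, symmetric] recip by (simp add: algebra_simps)
      also have "\<dots> \<le> \<Delta>t * (1/2 * c_p\<^sup>2 * R * (l2_norm \<Omega> (?f k))\<^sup>2
          - 1/2 * (1 / R) * (l2_norm \<Omega> (weak_curl \<Omega> (?u k)))\<^sup>2
          - c * recip R_m * (l2_norm \<Omega> (j k))\<^sup>2)"
        using work assms(5) by (intro mult_left_mono) auto
      also have "\<dots> = a k"
        unfolding a_def current by (simp add: algebra_simps)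
      finally show ?thesis .
    qed
    have "(\<Sum>k=0..n. a k)
        = - (1/2 * (1 / R)) * (\<Sum>k=0..n. \<Delta>t * (l2_norm \<Omega> (weak_curl \<Omega> (?u k)))\<^sup>2)
          - c * recip R_m * (\<Sum>k=0..n. \<Delta>t * (l2_norm \<Omega> (disc_curl \<Omega> Vc (?B k)))\<^sup>2)
          + 1/2 * \<Delta>t * c_p\<^sup>2 * R * (\<Sum>k=0..n. (l2_norm \<Omega> (?f k))\<^sup>2)"
      unfolding a_def sum.distrib sum_subtractf sum_distrib_left ..
    then show ?thesis
      using telescoped_bound[of e a n, OF step] unfolding e_def recip by (simp add: R)
  qed
  show ?thesis
    by (intro conjI allI impI energy stability) simp_all
qed

end
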